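(* Let $V$ be a finite-dimensional real vector space with basis $\mathcal{B}$, and let $\mathbf{T}:V\to V$ and $\eta:V\to\mathbb{R}$ be linear maps such that $(V,\mathcal{B},\mathbf{T},\eta)$ admits the Doob transform. Suppose $\mathcal{B}=\amalg_i\mathcal{B}^i$ is a disjoint union of nonempty subsets, and write $x^i:=\sum_{x\in\mathcal{B}^i}x$. Let $V'$ be the subspace of $V$ spanned by the $x^i$, and suppose $\mathbf{T}(V')\subseteq V'$. Define $\theta:\mathcal{B}\to\mathcal{B}':=\{x^i\}$ by $\theta(x):=x^i$ if $x\in\mathcal{B}^i$. Then the Markov chain on $\mathcal{B}$ defined by $\mathbf{T}:V\to V$ with rescaling function $\eta$ lumps weakly via $\theta$ to the Markov chain defined by the restriction $\mathbf{T}:V'\to V'$ (with basis $\mathcal{B}'$, and rescaling function the restriction $\eta:V'\to\mathbb{R}$), from any initial distribution of the form $$P\{X_0=x\}:=\alpha_{\theta(x)}\frac{\eta(x)}{\eta(\theta(x))},$$ where the $\alpha$s are constants depending only on $\theta(x)$. In particular, if $\eta\equiv1$ on $\mathcal{B}$, then the Markov chain lumps weakly in this way from any initial distribution which is constant on each $\mathcal{B}^i$.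
   Context: All Markov chains are discrete-time, time-homogeneous, with finite state space $\Omega$; the transition matrix $K$ is given by $K(x,y)=P\{X_t=y\mid X_{t-1}=x\}$. Doob transform. Let $V$ be a finite-dimensional real vector space with basis $\mathcal{B}$, $\mathbf{T}:V\to V$ linear, and let $K(x,y)$ ($x,y\in\mathcal{B}$) be the coefficient of $y$ in the expansion of $\mathbf{T}(x)$ in the basis $\mathcal{B}$. Let $\eta:V\to\mathbb{R}$ be linear. We say $(V,\mathcal{B},\mathbf{T},\eta)$ admits the Doob transform if $K(x,y)\ge 0$ for all $x,y\in\mathcal{B}$, $\eta(x)>0$ for all $x\in\mathcal{B}$, and $\eta\circ\mathbf{T}=\beta\eta$ for some $\beta>0$ (equivalently $\sum_{y}K(x,y)\eta(y)=\beta\eta(x)$ for all $x\in\mathcal{B}$). In that case the matrix $$\check K(x,y):=\frac1\beta K(x,y)\frac{\eta(y)}{\eta(x)}$$ is a transition matrix on state space $\mathcal{B}$; the corresponding Markov chain is called the Markov chain defined by $\mathbf{T}$ (on the basis $\mathcal{B}$, with rescaling function $\eta$). Weak lumping. Let $\{X_t\},\{X'_t\}$ be Markov chains on $\Omega,\Omega'$ with transition matrices $K,K'$. Then $\{X'_t\}$ is a weak lumping of $\{X_t\}$ via $\theta$ with initial distribution $X_0$ (one also says $\{X_t\}$ lumps weakly to $\{X'_t\}$ via $\theta$ from $X_0$) if $\theta:\Omega\to\Omega'$ is a surjection such that the process $\{\theta(X_t)\}$, started at the specified $X_0$, is a Markov chain with transition matrix $K'$. *)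

theory Defs
  imports "HOL-Probability.Probability"
begin

text \<open>
  A vector space with basis is represented by a subset \<open>V\<close> of a real vector space type together
  with a finite linearly independent set \<open>B\<close> spanning \<open>V\<close>.  A linear map on \<open>V\<close> is a linear map
  of the ambient type preserving \<open>V\<close>, so that restriction to a subspace leaves the map unchanged.
\<close>

definition admits_doob ::
  "'a::real_vector set \<Rightarrow> 'a set \<Rightarrow> ('a \<Rightarrow> 'a) \<Rightarrow> ('a \<Rightarrow> real) \<Rightarrow> bool" where
  "admits_doob V B T \<eta> \<longleftrightarrow>
     finite B \<and> independent B \<and> span B = V \<and>
     linear T \<and> T ` V \<subseteq> V \<and> linear \<eta> \<and>
     (\<forall>x\<in>B. \<forall>y\<in>B. representation B (T x) y \<ge> 0) \<and>
     (\<forall>x\<in>B. \<eta> x > 0) \<and>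
     (\<exists>\<beta>>0. \<forall>v\<in>V. \<eta> (T v) = \<beta> * \<eta> v)"

text \<open>The scalar is unique unless \<open>B\<close> is empty; there is no Markov chain on the empty set.\<close>

definition doob_eigenvalue :: "'a::real_vector set \<Rightarrow> ('a \<Rightarrow> 'a) \<Rightarrow> ('a \<Rightarrow> real) \<Rightarrow> real" where
  "doob_eigenvalue V T \<eta> = (THE \<beta>. \<beta> > 0 \<and> (\<forall>v\<in>V. \<eta> (T v) = \<beta> * \<eta> v))"

definition doob_matrix ::
  "'a::real_vector set \<Rightarrow> 'a set \<Rightarrow> ('a \<Rightarrow> 'a) \<Rightarrow> ('a \<Rightarrow> real) \<Rightarrow> 'a \<Rightarrow> 'a \<Rightarrow> real" where
  "doob_matrix V B T \<eta> x y =
     1 / doob_eigenvalue V T \<eta> * representation B (T x) y * (\<eta> y / \<eta> x)"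

definition prob_vector :: "'s set \<Rightarrow> ('s \<Rightarrow> real) \<Rightarrow> bool" where
  "prob_vector \<Omega> \<mu> \<longleftrightarrow> (\<forall>x\<in>\<Omega>. \<mu> x \<ge> 0) \<and> (\<Sum>x\<in>\<Omega>. \<mu> x) = 1"

definition transition_matrix :: "'s set \<Rightarrow> ('s \<Rightarrow> 's \<Rightarrow> real) \<Rightarrow> bool" where
  "transition_matrix \<Omega> K \<longleftrightarrow> finite \<Omega> \<and> (\<forall>x\<in>\<Omega>. prob_vector \<Omega> (K x))"

text \<open>
  The Markov property is conditional on every history \<open>X\<^sub>0 = h 0, \<dots>, X\<^sub>t = h t\<close> of positive
  probability; it combines memorylessness, time-homogeneity and the one-step probabilities.
\<close>

definition markov_chain ::
  "'w measure \<Rightarrow> (nat \<Rightarrow> 'w \<Rightarrow> 's) \<Rightarrow> 's set \<Rightarrow> ('s \<Rightarrow> 's \<Rightarrow> real) \<Rightarrow> bool" where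
  "markov_chain M X \<Omega> K \<longleftrightarrow>
     prob_space M \<and> transition_matrix \<Omega> K \<and>
     (\<forall>t. X t \<in> measurable M (count_space \<Omega>)) \<and>
     (\<forall>t h. \<forall>y\<in>\<Omega>. \<P>(\<omega> in M. \<forall>s\<le>t. X s \<omega> = h s) > 0 \<longrightarrow>
        \<P>(\<omega> in M. X (Suc t) \<omega> = y \<bar> \<forall>s\<le>t. X s \<omega> = h s) = K (h t) y)"

definition initial_distribution ::
  "'w measure \<Rightarrow> (nat \<Rightarrow> 'w \<Rightarrow> 's) \<Rightarrow> 's set \<Rightarrow> ('s \<Rightarrow> real) \<Rightarrow> bool" where
  "initial_distribution M X \<Omega> \<mu> \<longleftrightarrow> (\<forall>x\<in>\<Omega>. \<P>(\<omega> in M. X 0 \<omega> = x) = \<mu> x)"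

text \<open>
  The chain on \<open>\<Omega>\<close> with matrix \<open>K\<close> lumps weakly via \<open>\<theta>\<close> to the chain on \<open>\<Omega>'\<close> with matrix \<open>K'\<close>,
  from the initial distribution \<open>\<mu>\<close>.  Every realisation of the chain on a probability space with
  points of type \<open>'w\<close> is considered; as HOL cannot quantify over types inside a definition, \<open>'w\<close>
  is a parameter, to be left arbitrary.
\<close>

definition lumps_weakly ::
  "'w itself \<Rightarrow> 's set \<Rightarrow> ('s \<Rightarrow> 's \<Rightarrow> real) \<Rightarrow> ('s \<Rightarrow> 't) \<Rightarrow> 't set \<Rightarrow> ('t \<Rightarrow> 't \<Rightarrow> real) \<Rightarrow>
     ('s \<Rightarrow> real) \<Rightarrow> bool" where
  "lumps_weakly (_ :: 'w itself) \<Omega> K \<theta> \<Omega>' K' \<mu> \<longleftrightarrow>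
     transition_matrix \<Omega> K \<and> transition_matrix \<Omega>' K' \<and> prob_vector \<Omega> \<mu> \<and> \<theta> ` \<Omega> = \<Omega>' \<and>
     (\<forall>(M :: 'w measure) X.
        markov_chain M X \<Omega> K \<and> initial_distribution M X \<Omega> \<mu> \<longrightarrow>
        markov_chain M (\<lambda>t \<omega>. \<theta> (X t \<omega>)) \<Omega>' K')"

lemma doob_eigenvalue_eqI:
  assumes "admits_doob V B T \<eta>" "B \<noteq> {}" "\<beta> > 0" "\<And>v. v \<in> V \<Longrightarrow> \<eta> (T v) = \<beta> * \<eta> v"
  shows "doob_eigenvalue V T \<eta> = \<beta>"
proof -
  obtain b where b: "b \<in> B" using assms(2) by blast
  with assms(1) have bV: "b \<in> V" and pos: "\<eta> b > 0"
    by (auto simp: admits_doob_def intro: span_base)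
  show ?thesis
    unfolding doob_eigenvalue_def
  proof (rule the_equality)
    fix \<gamma> assume "\<gamma> > 0 \<and> (\<forall>v\<in>V. \<eta> (T v) = \<gamma> * \<eta> v)"
    with assms(4)[OF bV] bV have "\<gamma> * \<eta> b = \<beta> * \<eta> b" by metis
    with pos show "\<gamma> = \<beta>" by simp
  qed (use assms in auto)
qed

lemma transition_matrix_doob_matrix:
  assumes "admits_doob V B T \<eta>"
  shows "transition_matrix B (doob_matrix V B T \<eta>)"
proof -
  from assms have fin: "finite B" and ind: "independent B" and sp: "span B = V"
    and TV: "T ` V \<subseteq> V" and lin: "linear \<eta>"
    and K: "\<And>x y. x \<in> B \<Longrightarrow> y \<in> B \<Longrightarrow> representation B (T x) y \<ge> 0"
    and pos: "\<And>x. x \<in> B \<Longrightarrow> \<eta> x > 0"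
    by (auto simp: admits_doob_def)
  from assms obtain \<beta> where \<beta>: "\<beta> > 0" "\<And>v. v \<in> V \<Longrightarrow> \<eta> (T v) = \<beta> * \<eta> v"
    by (auto simp: admits_doob_def)
  have "prob_vector B (doob_matrix V B T \<eta> x)" if x: "x \<in> B" for x
  proof -
    have ev: "doob_eigenvalue V T \<eta> = \<beta>"
      using doob_eigenvalue_eqI[OF assms _ \<beta>] x by blast
    have xV: "x \<in> V" using x sp span_base by blast
    then have Tx: "T x \<in> span B" using TV sp by blast
    have "(\<Sum>y\<in>B. representation B (T x) y *\<^sub>R y) = T x"
      by (rule real_vector.sum_representation_eq[OF ind Tx fin]) simp
    then have "\<eta> (T x) = (\<Sum>y\<in>B. representation B (T x) y * \<eta> y)"
      using linear_sum[OF lin, of "\<lambda>y. representation B (T x) y *\<^sub>R y" B] 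
      by (simp add: linear_scale[OF lin])
    then have "(\<Sum>y\<in>B. representation B (T x) y * \<eta> y) = \<beta> * \<eta> x"
      using \<beta>(2)[OF xV] by simp
    moreover have "(\<Sum>y\<in>B. doob_matrix V B T \<eta> x y)
        = (\<Sum>y\<in>B. representation B (T x) y * \<eta> y) / (\<beta> * \<eta> x)"
      by (simp add: doob_matrix_def ev sum_divide_distrib)
    ultimately have "(\<Sum>y\<in>B. doob_matrix V B T \<eta> x y) = 1"
      using \<beta>(1) pos[OF x] by simp
    moreover have "doob_matrix V B T \<eta> x y \<ge> 0" if "y \<in> B" for y
      unfolding doob_matrix_def ev
      using \<beta>(1) K[OF x that] pos[OF x] pos[OF that] by simp
    ultimately show ?thesis by (simp add: prob_vector_def)
  qed
  with fin show ?thesis by (simp add: transition_matrix_def)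
qed

end

(*
  Put w x = \<eta> x / \<eta> (\<theta> x).  Comparing coefficients in T applied to a block sum shows that w, restricted
  to a block and pushed through one step of the chain, is on every block a multiple of w again, the
  multiple being the lumped transition probability.  Hence, starting from a mixture of the
  normalised restrictions of w to the blocks, the law of the current state given the whole lumped
  history is always the restriction of w to the current block, and so depends on the current block
  alone.
*)

theory Submission
  imports Defs
begin

section \<open>Finite histories of a chain, and a criterion for weak lumping by weights on
  fibres\<close>

section \<open>Weak lumping of finite chains\<close>

text \<open>The range condition on \<open>f\<close> is imposed only where \<open>P\<close> holds.
  When \<open>P\<close> contains a lumped history, the sum can therefore run over the states of a
  single fibre.\<close>

lemma (in prob_space) prob_finite_partition:
  assumes "finite A" "\<And>a. a \<in> A \<Longrightarrow> {\<omega>\<in>space M. P \<omega> \<and> f \<omega> = a} \<in> events"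
    and "\<And>\<omega>. \<omega> \<in> space M \<Longrightarrow> P \<omega> \<Longrightarrow> f \<omega> \<in> A"
  shows "\<P>(\<omega> in M. P \<omega>) = (\<Sum>a\<in>A. \<P>(\<omega> in M. P \<omega> \<and> f \<omega> = a))"
proof -
  have "{\<omega>\<in>space M. P \<omega>} = (\<Union>a\<in>A. {\<omega>\<in>space M. P \<omega> \<and> f \<omega> = a})"
    using assms(3) by auto
  moreover have "prob (\<Union>a\<in>A. {\<omega>\<in>space M. P \<omega> \<and> f \<omega> = a})
      = (\<Sum>a\<in>A. \<P>(\<omega> in M. P \<omega> \<and> f \<omega> = a))"
    by (rule finite_measure_finite_Union) (use assms in \<open>auto simp: disjoint_family_on_def\<close>)
  ultimately show ?thesis by simp
qed

text \<open>On a finite state space there are only finitely many histories up to time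
  \<open>t\<close>, so any predicate \<open>Q\<close> on histories cuts out a finite union of path
  events. Using \<open>restrict\<close> makes histories elements of \<open>PiE\<close>, where
  equality of functions is agreement at the times up to \<open>t\<close>.\<close>

lemma count_space_history_sets:
  fixes X :: "nat \<Rightarrow> 'w \<Rightarrow> 's"
  assumes fin: "finite \<Omega>" and meas: "\<And>t. X t \<in> measurable M (count_space \<Omega>)"
  shows "{\<omega>\<in>space M. Q (restrict (\<lambda>s. X s \<omega>) {..t})} \<in> sets M"
proof -
  let ?P = "PiE {..t} (\<lambda>_. \<Omega>)"
  have val: "X s \<omega> \<in> \<Omega>" if "\<omega> \<in> space M" for s \<omega>
    using measurable_space[OF meas that] by simp
  have ev: "{\<omega>\<in>space M. \<forall>s\<le>t. X s \<omega> = g s} \<in> sets M" for g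
  proof -
    have "X s -` {g s} \<inter> space M \<in> sets M" for s
    proof (cases "g s \<in> \<Omega>")
      case True
      then show ?thesis by (intro measurable_sets[OF meas]) auto
    next
      \<comment> \<open>\<open>{g s}\<close> is not measurable in
        \<open>count_space \<Omega>\<close> here, but the process never leaves
        \<open>\<Omega>\<close>, so the preimage is empty.\<close>
      case False
      then have "X s \<omega> \<noteq> g s" if "\<omega> \<in> space M" for \<omega>
        using val[OF that, of s] by metis
      then have "X s -` {g s} \<inter> space M = {}" by blast
      then show ?thesis by simp
    qed
    then have "(\<Inter>s\<in>{..t}. X s -` {g s} \<inter> space M) \<in> sets M"
      by (intro sets.finite_INT) auto
    moreover have "(\<Inter>s\<in>{..t}. X s -` {g s} \<inter> space M) = {\<omega>\<in>space M. \<forall>s\<le>t. X s \<omega> = g s}"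
      by auto
    ultimately show ?thesis by (simp only:)
  qed
  have "{\<omega>\<in>space M. Q (restrict (\<lambda>s. X s \<omega>) {..t})}
      = (\<Union>g\<in>{g\<in>?P. Q g}. {\<omega>\<in>space M. \<forall>s\<le>t. X s \<omega> = g s})"
  proof (intro equalityI subsetI)
    fix \<omega> assume "\<omega> \<in> {\<omega>\<in>space M. Q (restrict (\<lambda>s. X s \<omega>) {..t})}"
    then show "\<omega> \<in> (\<Union>g\<in>{g\<in>?P. Q g}. {\<omega>\<in>space M. \<forall>s\<le>t. X s \<omega> = g s})"
      using val by (intro UN_I[of "restrict (\<lambda>s. X s \<omega>) {..t}"]) auto
  next
    fix \<omega> assume "\<omega> \<in> (\<Union>g\<in>{g\<in>?P. Q g}. {\<omega>\<in>space M. \<forall>s\<le>t. X s \<omega> = g s})"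
    then obtain g where g: "g \<in> ?P" "Q g" "\<omega> \<in> space M" "\<forall>s\<le>t. X s \<omega> = g s" by auto
    then have "restrict (\<lambda>s. X s \<omega>) {..t} = g"
      by (auto simp: fun_eq_iff PiE_def extensional_def)
    with g show "\<omega> \<in> {\<omega>\<in>space M. Q (restrict (\<lambda>s. X s \<omega>) {..t})}" by simp
  qed
  moreover have "finite {g\<in>?P. Q g}" using fin by (simp add: finite_PiE)
  ultimately show ?thesis by (simp only:) (intro sets.finite_UN ev)
qed

text \<open>The Markov property is defined by conditioning on one complete history, whereas a lumped
  history comprises many. Summing over the complete histories that satisfy \<open>Q\<close> gives
  the general case: all of them end in \<open>y\<close>, so the common factor \<open>K y z\<close>
  comes out of the sum. The product form also covers events of probability zero.\<close>

lemma markov_chain_step: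
  assumes mc: "markov_chain M X \<Omega> K" and z: "z \<in> \<Omega>"
    and last: "\<And>g. Q g \<Longrightarrow> g t = y"
  shows "\<P>(\<omega> in M. Q (restrict (\<lambda>s. X s \<omega>) {..t}) \<and> X (Suc t) \<omega> = z)
    = \<P>(\<omega> in M. Q (restrict (\<lambda>s. X s \<omega>) {..t})) * K y z"
proof -
  interpret prob_space M using mc by (simp add: markov_chain_def)
  have fin: "finite \<Omega>" and meas: "\<And>t. X t \<in> measurable M (count_space \<Omega>)"
    using mc by (auto simp: markov_chain_def transition_matrix_def)
  note sets1 = count_space_history_sets[where X = X, OF fin meas]
  have val: "X s \<omega> \<in> \<Omega>" if "\<omega> \<in> space M" for s \<omega>
    using measurable_space[OF meas that] by simp
  let ?A = "PiE {..t} (\<lambda>_. \<Omega>)"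
  let ?r = "\<lambda>\<omega>. restrict (\<lambda>s. X s \<omega>) {..t}"
  have finA: "finite ?A" using fin by (simp add: finite_PiE)
  have rA: "?r \<omega> \<in> ?A" if "\<omega> \<in> space M" for \<omega> using val[OF that] by auto
  have zmeas: "{\<omega>\<in>space M. X (Suc t) \<omega> = z} \<in> events"
  proof -
    have "{\<omega>\<in>space M. X (Suc t) \<omega> = z} = X (Suc t) -` {z} \<inter> space M" by auto
    then show ?thesis using measurable_sets[OF meas, of "{z}" "Suc t"] z by simp
  qed
  have ev: "{\<omega>\<in>space M. R (?r \<omega>) \<and> X (Suc t) \<omega> = z} \<in> events" for R
  proof -
    have "{\<omega>\<in>space M. R (?r \<omega>) \<and> X (Suc t) \<omega> = z}
        = {\<omega>\<in>space M. R (?r \<omega>)} \<inter> {\<omega>\<in>space M. X (Suc t) \<omega> = z}" by auto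
    then show ?thesis using sets.Int[OF sets1[of R t] zmeas] by simp
  qed
  have path: "\<P>(\<omega> in M. ?r \<omega> = g \<and> X (Suc t) \<omega> = z) = \<P>(\<omega> in M. ?r \<omega> = g) * K (g t) z"
    if g: "g \<in> ?A" for g
  proof -
    have eq: "?r \<omega> = g \<longleftrightarrow> (\<forall>s\<le>t. X s \<omega> = g s)" for \<omega>
      using g by (auto simp: fun_eq_iff PiE_def extensional_def)
    show ?thesis
    proof (cases "\<P>(\<omega> in M. \<forall>s\<le>t. X s \<omega> = g s) > 0")
      case True
      then have "\<P>(\<omega> in M. X (Suc t) \<omega> = z \<bar> \<forall>s\<le>t. X s \<omega> = g s) = K (g t) z"
        using mc z by (simp add: markov_chain_def)
      then show ?thesis
        using True unfolding eq cond_prob_def by (simp add: field_simps conj_commute)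
    next
      \<comment> \<open>The definition of a chain says nothing about null histories; both sides
        vanish by monotonicity.\<close>
      case False
      then have 0: "\<P>(\<omega> in M. ?r \<omega> = g) = 0"
        unfolding eq by (simp add: zero_less_measure_iff)
      have "\<P>(\<omega> in M. ?r \<omega> = g \<and> X (Suc t) \<omega> = z) \<le> \<P>(\<omega> in M. ?r \<omega> = g)"
        by (rule finite_measure_mono) (use sets1[of "\<lambda>r. r = g" t] in auto)
      then have "\<P>(\<omega> in M. ?r \<omega> = g \<and> X (Suc t) \<omega> = z) = 0"
        unfolding 0 by (simp add: measure_le_0_iff)
      with 0 show ?thesis by simp
    qed
  qed
  have "\<P>(\<omega> in M. Q (?r \<omega>) \<and> X (Suc t) \<omega> = z)
      = (\<Sum>g\<in>?A. \<P>(\<omega> in M. (Q (?r \<omega>) \<and> X (Suc t) \<omega> = z) \<and> ?r \<omega> = g))"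
  proof (rule prob_finite_partition[OF finA])
    show "{\<omega>\<in>space M. (Q (?r \<omega>) \<and> X (Suc t) \<omega> = z) \<and> ?r \<omega> = g} \<in> events" for g
    proof -
      have "(Q (?r \<omega>) \<and> X (Suc t) \<omega> = z) \<and> ?r \<omega> = g
          \<longleftrightarrow> (Q (?r \<omega>) \<and> ?r \<omega> = g) \<and> X (Suc t) \<omega> = z" for \<omega> by blast
      then show ?thesis using ev[of "\<lambda>r. Q r \<and> r = g"] by simp
    qed
  qed (rule rA)
  also have "\<dots> = (\<Sum>g\<in>?A. \<P>(\<omega> in M. Q (?r \<omega>) \<and> ?r \<omega> = g) * K y z)"
  proof (rule sum.cong[OF refl])
    fix g assume g: "g \<in> ?A"
    show "\<P>(\<omega> in M. (Q (?r \<omega>) \<and> X (Suc t) \<omega> = z) \<and> ?r \<omega> = g)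
        = \<P>(\<omega> in M. Q (?r \<omega>) \<and> ?r \<omega> = g) * K y z"
    proof (cases "Q g")
      case True
      then have "(Q (?r \<omega>) \<and> X (Suc t) \<omega> = z) \<and> ?r \<omega> = g \<longleftrightarrow> ?r \<omega> = g \<and> X (Suc t) \<omega> = z"
        and "Q (?r \<omega>) \<and> ?r \<omega> = g \<longleftrightarrow> ?r \<omega> = g" for \<omega> by blast+
      then show ?thesis using path[OF g] last[OF True] by simp
    next
      case False
      then have "{\<omega>\<in>space M. (Q (?r \<omega>) \<and> X (Suc t) \<omega> = z) \<and> ?r \<omega> = g} = {}"
        and "{\<omega>\<in>space M. Q (?r \<omega>) \<and> ?r \<omega> = g} = {}" by blast+
      then show ?thesis by (simp only: measure_empty mult_zero_left)
    qed
  qed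
  also have "\<dots> = \<P>(\<omega> in M. Q (?r \<omega>)) * K y z"
  proof -
    have "\<P>(\<omega> in M. Q (?r \<omega>)) = (\<Sum>g\<in>?A. \<P>(\<omega> in M. Q (?r \<omega>) \<and> ?r \<omega> = g))"
    proof (rule prob_finite_partition[OF finA])
      show "{\<omega>\<in>space M. Q (?r \<omega>) \<and> ?r \<omega> = g} \<in> events" for g
        by (rule sets1)
    qed (rule rA)
    then show ?thesis by (simp only: sum_distrib_right)
  qed
  finally show ?thesis .
qed

text \<open>The proof tracks the joint probability of a lumped history and the current state. It has
  the form \<open>C * w y\<close> on the current fibre: \<open>init\<close> gives this at time 0,
  and \<open>step\<close> preserves it, multiplying \<open>C\<close> by an entry of
  \<open>K'\<close>. Since \<open>w\<close> sums to 1 on each fibre, \<open>C\<close> is the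
  probability of the lumped history itself.\<close>

lemma lumps_weakly_fibre_weights:
  fixes K :: "'s \<Rightarrow> 's \<Rightarrow> real" and w \<mu> :: "'s \<Rightarrow> real" and \<alpha> :: "'t \<Rightarrow> real"
  assumes K: "transition_matrix \<Omega> K" and K': "transition_matrix \<Omega>' K'"
    and \<mu>: "prob_vector \<Omega> \<mu>" and surj: "\<theta> ` \<Omega> = \<Omega>'"
    and w: "\<And>b. b \<in> \<Omega>' \<Longrightarrow> (\<Sum>x | x \<in> \<Omega> \<and> \<theta> x = b. w x) = 1"
    and step: "\<And>b y. b \<in> \<Omega>' \<Longrightarrow> y \<in> \<Omega> \<Longrightarrow>
      (\<Sum>x | x \<in> \<Omega> \<and> \<theta> x = b. w x * K x y) = K' b (\<theta> y) * w y"
    and init: "\<And>x. x \<in> \<Omega> \<Longrightarrow> \<mu> x = \<alpha> (\<theta> x) * w x"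
  shows "lumps_weakly TYPE('w) \<Omega> K \<theta> \<Omega>' K' \<mu>"
proof -
  have "markov_chain M (\<lambda>t \<omega>. \<theta> (X t \<omega>)) \<Omega>' K'"
    if mc: "markov_chain M X \<Omega> K" and X0: "initial_distribution M X \<Omega> \<mu>"
    for M :: "'w measure" and X
  proof -
    interpret prob_space M using mc by (simp add: markov_chain_def)
    have fin: "finite \<Omega>" and meas: "\<And>t. X t \<in> measurable M (count_space \<Omega>)"
      using mc by (auto simp: markov_chain_def transition_matrix_def)
    have val: "X s \<omega> \<in> \<Omega>" if "\<omega> \<in> space M" for s \<omega>
      using measurable_space[OF meas that] by simp
    define H where "H t h \<omega> \<longleftrightarrow> (\<forall>s\<le>t. \<theta> (X s \<omega>) = h s)" for t h \<omega>
    have HSuc: "H (Suc t) h \<omega> \<longleftrightarrow> H t h \<omega> \<and> \<theta> (X (Suc t) \<omega>) = h (Suc t)" for t h \<omega>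
      by (auto simp: H_def le_Suc_eq)
    have Hlast: "\<theta> (X t \<omega>) = h t" if "H t h \<omega>" for t h \<omega>
      using that by (simp add: H_def)
    have history_sets: "{\<omega>\<in>space M. R \<omega>} \<in> events"
      if "\<And>\<omega>. R \<omega> \<longleftrightarrow> Q (restrict (\<lambda>s. X s \<omega>) {..n})" for R Q n
      unfolding that by (rule count_space_history_sets[OF fin meas])
    have Hsets: "{\<omega>\<in>space M. H t h \<omega> \<and> X t \<omega> = y} \<in> events" for t h y
      by (rule history_sets[of _ "\<lambda>g. (\<forall>s\<le>t. \<theta> (g s) = h s) \<and> g t = y" t])
        (simp add: H_def)
    have Hstep: "\<P>(\<omega> in M. (H t h \<omega> \<and> X t \<omega> = y) \<and> X (Suc t) \<omega> = z)
        = \<P>(\<omega> in M. H t h \<omega> \<and> X t \<omega> = y) * K y z" if "z \<in> \<Omega>" for t h y z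
      using markov_chain_step[OF mc that, of "\<lambda>g. (\<forall>s\<le>t. \<theta> (g s) = h s) \<and> g t = y" t y]
      by (simp add: H_def)
    have Hsets2: "{\<omega>\<in>space M. (H t h \<omega> \<and> X (Suc t) \<omega> = z) \<and> X t \<omega> = y} \<in> events" for t h y z
      by (rule history_sets[of _
            "\<lambda>g. ((\<forall>s\<le>t. \<theta> (g s) = h s) \<and> g (Suc t) = z) \<and> g t = y" "Suc t"])
        (simp add: H_def)
    \<comment> \<open>Splitting by the state at time \<open>t\<close> and applying
      \<open>step\<close> pushes a law proportional to \<open>w\<close> one step forward. This
      serves both the induction for \<open>law\<close> and the final transition probability.\<close>
    have next_law: "\<P>(\<omega> in M. H t h \<omega> \<and> X (Suc t) \<omega> = z) = C * (K' (h t) (\<theta> z) * w z)"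
      if z: "z \<in> \<Omega>" and ht: "h t \<in> \<Omega>'"
        and C: "\<And>y. y \<in> \<Omega> \<Longrightarrow> \<theta> y = h t \<Longrightarrow> \<P>(\<omega> in M. H t h \<omega> \<and> X t \<omega> = y) = C * w y"
      for t h z C
    proof -
      have "\<P>(\<omega> in M. H t h \<omega> \<and> X (Suc t) \<omega> = z)
          = (\<Sum>y | y \<in> \<Omega> \<and> \<theta> y = h t. \<P>(\<omega> in M. (H t h \<omega> \<and> X (Suc t) \<omega> = z) \<and> X t \<omega> = y))"
        by (rule prob_finite_partition) (use fin Hsets2 val Hlast in auto)
      also have "\<dots> = (\<Sum>y | y \<in> \<Omega> \<and> \<theta> y = h t. C * (w y * K y z))"
      proof (rule sum.cong[OF refl])
        fix y assume y: "y \<in> {y. y \<in> \<Omega> \<and> \<theta> y = h t}"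
        have "((H t h \<omega> \<and> X (Suc t) \<omega> = z) \<and> X t \<omega> = y)
            \<longleftrightarrow> ((H t h \<omega> \<and> X t \<omega> = y) \<and> X (Suc t) \<omega> = z)" for \<omega> by auto
        then show "\<P>(\<omega> in M. (H t h \<omega> \<and> X (Suc t) \<omega> = z) \<and> X t \<omega> = y) = C * (w y * K y z)"
          using y by (simp only: Hstep[OF z]) (simp add: C)
      qed
      also have "\<dots> = C * (K' (h t) (\<theta> z) * w z)"
        by (simp add: sum_distrib_left[symmetric] step[OF ht z])
      finally show ?thesis .
    qed
    \<comment> \<open>The point is that \<open>C\<close> does not depend on \<open>y\<close>. Its
      value may stay unspecified, because summing over the fibre later identifies it.\<close>
    have law: "\<exists>C. \<forall>y\<in>\<Omega>. \<theta> y = h t \<longrightarrow> \<P>(\<omega> in M. H t h \<omega> \<and> X t \<omega> = y) = C * w y"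
      if h: "\<And>s. s \<le> t \<Longrightarrow> h s \<in> \<Omega>'" for t h
      using h
    proof (induction t)
      case 0
      have "\<P>(\<omega> in M. H 0 h \<omega> \<and> X 0 \<omega> = y) = \<alpha> (h 0) * w y" if "y \<in> \<Omega>" "\<theta> y = h 0" for y
      proof -
        have "(H 0 h \<omega> \<and> X 0 \<omega> = y) \<longleftrightarrow> X 0 \<omega> = y" for \<omega>
          using that by (auto simp: H_def)
        then show ?thesis
          using X0 init[OF that(1)] that by (simp add: initial_distribution_def)
      qed
      then show ?case by blast
    next
      case (Suc t)
      then obtain C where C: "\<And>y. y \<in> \<Omega> \<Longrightarrow> \<theta> y = h t \<Longrightarrow> \<P>(\<omega> in M. H t h \<omega> \<and> X t \<omega> = y) = C * w y"
        by (metis le_SucI)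
      have "\<P>(\<omega> in M. H (Suc t) h \<omega> \<and> X (Suc t) \<omega> = z) = C * K' (h t) (h (Suc t)) * w z"
        if z: "z \<in> \<Omega>" "\<theta> z = h (Suc t)" for z
      proof -
        have "H (Suc t) h \<omega> \<and> X (Suc t) \<omega> = z \<longleftrightarrow> H t h \<omega> \<and> X (Suc t) \<omega> = z" for \<omega>
          using z by (auto simp: HSuc)
        moreover have "\<P>(\<omega> in M. H t h \<omega> \<and> X (Suc t) \<omega> = z) = C * (K' (h t) (\<theta> z) * w z)"
          by (rule next_law[OF z(1) _ C]) (use Suc.prems in auto)
        ultimately show ?thesis by (simp only: z(2) mult.assoc)
      qed
      then show ?case by blast
    qed
    have "\<P>(\<omega> in M. \<theta> (X (Suc t) \<omega>) = b \<bar> \<forall>s\<le>t. \<theta> (X s \<omega>) = h s) = K' (h t) b"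
      if b: "b \<in> \<Omega>'" and pos: "\<P>(\<omega> in M. \<forall>s\<le>t. \<theta> (X s \<omega>) = h s) > 0" for t h b
    proof -
      \<comment> \<open>The function \<open>h\<close> is arbitrary, but an outcome realising it
        shows that its values up to \<open>t\<close> lie in \<open>\<Omega>'\<close>, as
        \<open>law\<close> requires.\<close>
      have "{\<omega>\<in>space M. \<forall>s\<le>t. \<theta> (X s \<omega>) = h s} \<noteq> {}"
        using pos by (metis less_irrefl measure_empty)
      then obtain \<omega>0 where \<omega>0: "\<omega>0 \<in> space M" "\<And>s. s \<le> t \<Longrightarrow> \<theta> (X s \<omega>0) = h s" by auto
      have h: "h s \<in> \<Omega>'" if "s \<le> t" for s
        using \<omega>0(2)[OF that] val[OF \<omega>0(1), of s] surj by (metis imageI)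
      obtain C where C: "\<And>y. y \<in> \<Omega> \<Longrightarrow> \<theta> y = h t \<Longrightarrow> \<P>(\<omega> in M. H t h \<omega> \<and> X t \<omega> = y) = C * w y"
        using law[of t h] h by blast
      have "\<P>(\<omega> in M. H t h \<omega>)
          = (\<Sum>y | y \<in> \<Omega> \<and> \<theta> y = h t. \<P>(\<omega> in M. H t h \<omega> \<and> X t \<omega> = y))"
        by (rule prob_finite_partition) (use fin Hsets val Hlast in auto)
      also have "\<dots> = (\<Sum>y | y \<in> \<Omega> \<and> \<theta> y = h t. C * w y)"
        by (rule sum.cong) (auto simp: C)
      also have "\<dots> = C"
        using w[of "h t"] h[of t] by (simp add: sum_distrib_left[symmetric])
      finally have PC: "\<P>(\<omega> in M. H t h \<omega>) = C" .
      have ev: "{\<omega>\<in>space M. (H t h \<omega> \<and> \<theta> (X (Suc t) \<omega>) = b) \<and> X (Suc t) \<omega> = z} \<in> events" for z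
      proof -
        \<comment> \<open>Overwriting \<open>h\<close> at \<open>Suc t\<close> turns the event into
          a lumped history one step longer, so \<open>Hsets\<close> applies.\<close>
        have "H (Suc t) (h(Suc t := b)) \<omega> \<longleftrightarrow> H t h \<omega> \<and> \<theta> (X (Suc t) \<omega>) = b" for \<omega>
          unfolding HSuc by (simp add: H_def)
        then show ?thesis using Hsets[of "Suc t" "h(Suc t := b)" z] by simp
      qed
      have "\<P>(\<omega> in M. H t h \<omega> \<and> \<theta> (X (Suc t) \<omega>) = b)
          = (\<Sum>z | z \<in> \<Omega> \<and> \<theta> z = b. \<P>(\<omega> in M. (H t h \<omega> \<and> \<theta> (X (Suc t) \<omega>) = b) \<and> X (Suc t) \<omega> = z))"
        by (rule prob_finite_partition) (use fin ev val in auto)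
      also have "\<dots> = (\<Sum>z | z \<in> \<Omega> \<and> \<theta> z = b. C * K' (h t) b * w z)"
      proof (rule sum.cong[OF refl])
        fix z assume z: "z \<in> {z. z \<in> \<Omega> \<and> \<theta> z = b}"
        then have "((H t h \<omega> \<and> \<theta> (X (Suc t) \<omega>) = b) \<and> X (Suc t) \<omega> = z)
            \<longleftrightarrow> (H t h \<omega> \<and> X (Suc t) \<omega> = z)" for \<omega> by auto
        then show "\<P>(\<omega> in M. (H t h \<omega> \<and> \<theta> (X (Suc t) \<omega>) = b) \<and> X (Suc t) \<omega> = z)
            = C * K' (h t) b * w z"
          using next_law[OF _ h[OF order_refl] C, of z] z by simp
      qed
      also have "\<dots> = C * K' (h t) b"
        using w[OF b] by (simp add: sum_distrib_left[symmetric])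
      finally have PCK: "\<P>(\<omega> in M. H t h \<omega> \<and> \<theta> (X (Suc t) \<omega>) = b) = C * K' (h t) b" .
      \<comment> \<open>By \<open>PC\<close>, the conditioning event has probability
        \<open>C > 0\<close>, which cancels in the quotient.\<close>
      show ?thesis
        using pos PC PCK unfolding cond_prob_def H_def by (simp add: conj_commute)
    qed
    moreover have "(\<lambda>\<omega>. \<theta> (X t \<omega>)) \<in> measurable M (count_space \<Omega>')" for t
      by (rule measurable_compose[OF meas]) (use surj in auto)
    ultimately show ?thesis
      using K' prob_space_axioms by (auto simp: markov_chain_def)
  qed
  then show ?thesis using K K' \<mu> surj by (auto simp: lumps_weakly_def)
qed

section \<open>Sums over blocks of a basis: injectivity, independence and coefficients\<close>

section \<open>Block sums of a basis\<close>

lemma representation_sum_scaleR_basis: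
  fixes B :: "'a::real_vector set"
  assumes "finite B" "independent B" "y \<in> B"
  shows "representation B (\<Sum>x\<in>B. f x *\<^sub>R x) y = f y"
proof -
  have "representation B (\<Sum>x\<in>B. f x *\<^sub>R x) y = (\<Sum>x\<in>B. representation B (f x *\<^sub>R x) y)"
    using assms(2) by (subst real_vector.representation_sum) (auto intro: span_base span_scale)
  also have "\<dots> = (\<Sum>x\<in>B. if y = x then f x else 0)"
    using assms(2)
    by (intro sum.cong) (auto simp: real_vector.representation_scale real_vector.representation_basis span_base)
  also have "\<dots> = f y" using assms by simp
  finally show ?thesis .
qed

text \<open>The coefficients of a block sum form the indicator function of the block, so the sum
  determines the block; disjointness and nonemptiness then determine the index. This ensures that a
  map sending each basis vector to its block sum has exactly the blocks as fibres.\<close>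

lemma inj_on_block_sums:
  fixes B :: "'a::real_vector set"
  assumes "finite B" "independent B" and sub: "\<And>i. i \<in> I \<Longrightarrow> block i \<subseteq> B"
    and "disjoint_family_on block I" "\<And>i. i \<in> I \<Longrightarrow> block i \<noteq> {}"
  shows "inj_on (\<lambda>i. \<Sum>x\<in>block i. x) I"
proof (rule inj_onI)
  fix i j assume ij: "i \<in> I" "j \<in> I" and eq: "(\<Sum>x\<in>block i. x) = (\<Sum>x\<in>block j. x)"
  have rep: "representation B (\<Sum>x\<in>A. x) y = of_bool (y \<in> A)" if "A \<subseteq> B" "y \<in> B" for A y
  proof -
    have "(\<Sum>x\<in>A. x) = (\<Sum>x\<in>B. of_bool (x \<in> A) *\<^sub>R x)"
      by (rule sum.mono_neutral_cong_left) (use assms(1) that in auto)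
    then show ?thesis using representation_sum_scaleR_basis[OF assms(1,2) that(2)] by simp
  qed
  obtain x where x: "x \<in> block i" using assms(5) ij by blast
  then have "of_bool (x \<in> block i) = (of_bool (x \<in> block j) :: real)"
    using rep[OF sub[OF ij(1)], of x] rep[OF sub[OF ij(2)], of x] sub[OF ij(1)] eq
    by (simp add: subset_iff)
  then have "x \<in> block j" using x by simp
  with x assms(4) ij show "i = j" by (auto simp: disjoint_family_on_def)
qed

context
  fixes B :: "'a::real_vector set" and \<theta> :: "'a \<Rightarrow> 'a"
  assumes fin: "finite B" and ind: "independent B"
    and fibre_sum: "\<And>b. b \<in> \<theta> ` B \<Longrightarrow> (\<Sum>x | x \<in> B \<and> \<theta> x = b. x) = b"
begin

text \<open>The blocks are now the fibres of \<open>\<theta>\<close>, each labelled by its own sum.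
  Expanding the labels shows that combinations of block sums are the combinations of basis vectors
  with coefficients constant on fibres.\<close>

lemma sum_scaleR_fibres: "(\<Sum>b\<in>\<theta> ` B. u b *\<^sub>R b) = (\<Sum>x\<in>B. u (\<theta> x) *\<^sub>R x)"
proof -
  have "(\<Sum>x\<in>B. u (\<theta> x) *\<^sub>R x) = (\<Sum>b\<in>\<theta> ` B. \<Sum>x | x \<in> B \<and> \<theta> x = b. u (\<theta> x) *\<^sub>R x)"
    using fin by (rule sum.image_gen)
  also have "\<dots> = (\<Sum>b\<in>\<theta> ` B. u b *\<^sub>R (\<Sum>x | x \<in> B \<and> \<theta> x = b. x))"
    by (auto simp: scaleR_sum_right intro!: sum.cong)
  also have "\<dots> = (\<Sum>b\<in>\<theta> ` B. u b *\<^sub>R b)"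
    by (rule sum.cong) (simp_all add: fibre_sum)
  finally show ?thesis ..
qed

text \<open>A linear relation among block sums with coefficients \<open>u\<close> is one among basis
  vectors with coefficients \<open>u (\<theta> x)\<close>, and these reach every value of
  \<open>u\<close> on the image.\<close>

lemma independent_fibre_sums: "independent (\<theta> ` B)"
proof -
  have "u (\<theta> x) = 0" if "(\<Sum>b\<in>\<theta> ` B. u b *\<^sub>R b) = 0" "x \<in> B" for u x
    using independentD[OF ind fin order_refl _ that(2), of "\<lambda>x. u (\<theta> x)"] that(1)
    by (simp add: sum_scaleR_fibres)
  then show ?thesis
    using fin by (intro real_vector.independent_if_scalars_zero) auto
qed

text \<open>Expanding \<open>v\<close> first in block sums and then in \<open>B\<close> gives
  coefficients constant on fibres; uniqueness of coefficients in \<open>B\<close> identifies the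
  constants.\<close>

lemma representation_fibre_sums:
  assumes v: "v \<in> span (\<theta> ` B)" and y: "y \<in> B"
  shows "representation (\<theta> ` B) v (\<theta> y) = representation B v y"
proof -
  let ?r = "representation (\<theta> ` B) v"
  have "v = (\<Sum>b\<in>\<theta> ` B. ?r b *\<^sub>R b)"
    using real_vector.sum_representation_eq[OF independent_fibre_sums v, of "\<theta> ` B"] fin by simp
  then have "v = (\<Sum>x\<in>B. ?r (\<theta> x) *\<^sub>R x)" by (simp add: sum_scaleR_fibres)
  then have "representation B v y = representation B (\<Sum>x\<in>B. ?r (\<theta> x) *\<^sub>R x) y" by simp
  also have "\<dots> = ?r (\<theta> y)" using representation_sum_scaleR_basis[OF fin ind y] .
  finally show ?thesis ..
qed

end

section \<open>The weight criterion applied to Doob transforms\<close>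

section \<open>Lumping Doob transforms\<close>

context
  fixes B :: "'a::real_vector set" and T :: "'a \<Rightarrow> 'a" and \<eta> :: "'a \<Rightarrow> real" and \<theta> :: "'a \<Rightarrow> 'a"
  assumes doob: "admits_doob UNIV B T \<eta>"
    and fibre_sum: "\<And>b. b \<in> \<theta> ` B \<Longrightarrow> (\<Sum>x | x \<in> B \<and> \<theta> x = b. x) = b"
    and invariant: "T ` span (\<theta> ` B) \<subseteq> span (\<theta> ` B)"
begin

private lemma basis: "finite B" "independent B" "span B = UNIV"
  and linear: "linear T" "linear \<eta>"
  and coeff_nonneg: "\<And>x y. x \<in> B \<Longrightarrow> y \<in> B \<Longrightarrow> representation B (T x) y \<ge> 0"
  and \<eta>_pos: "\<And>x. x \<in> B \<Longrightarrow> \<eta> x > 0"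
  using doob by (auto simp: admits_doob_def)

private lemma \<eta>_fibre_sum: "b \<in> \<theta> ` B \<Longrightarrow> (\<Sum>x | x \<in> B \<and> \<theta> x = b. \<eta> x) = \<eta> b"
  using linear_sum[OF linear(2), of "\<lambda>x. x" "{x. x \<in> B \<and> \<theta> x = b}"] fibre_sum[of b] by simp

private lemma \<eta>_fibre_sum_pos: "b \<in> \<theta> ` B \<Longrightarrow> \<eta> b > 0"
  unfolding \<eta>_fibre_sum[symmetric]
  by (rule sum_pos) (use basis(1) \<eta>_pos in auto)

text \<open>Invariance puts \<open>T b\<close> in the span of the block sums, so its coefficient at
  \<open>y\<close> depends on \<open>\<theta> y\<close> alone; linearity splits the same coefficient
  over the fibre of \<open>b\<close>. Up to the factors of the Doob transform, this is the step
  condition of the lumping criterion.\<close>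

private lemma coeff_fibre_sum:
  assumes b: "b \<in> \<theta> ` B" and y: "y \<in> B"
  shows "(\<Sum>x | x \<in> B \<and> \<theta> x = b. representation B (T x) y) = representation (\<theta> ` B) (T b) (\<theta> y)"
proof -
  have Tb: "T b \<in> span (\<theta> ` B)" using invariant span_base[OF b] by blast
  have "representation (\<theta> ` B) (T b) (\<theta> y) = representation B (T b) y"
    by (rule representation_fibre_sums[where B = B and \<theta> = \<theta>, OF basis(1,2)])
      (simp_all only: fibre_sum Tb y)
  also have "\<dots> = representation B (\<Sum>x | x \<in> B \<and> \<theta> x = b. T x) y"
    using linear_sum[OF linear(1), of "\<lambda>x. x" "{x. x \<in> B \<and> \<theta> x = b}"] fibre_sum[OF b] by simp
  also have "\<dots> = (\<Sum>x | x \<in> B \<and> \<theta> x = b. representation B (T x) y)"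
    by (subst real_vector.representation_sum) (auto simp: basis)
  finally show ?thesis ..
qed

text \<open>By \<open>coeff_fibre_sum\<close>, the coefficients in the new basis are sums of
  nonnegative coefficients in the old one. The eigenvalue equation for \<open>\<eta>\<close>
  restricts to the subspace.\<close>

lemma admits_doob_fibre_sums: "admits_doob (span (\<theta> ` B)) (\<theta> ` B) T \<eta>"
proof -
  have "representation (\<theta> ` B) (T b) c \<ge> 0" if "b \<in> \<theta> ` B" "c \<in> \<theta> ` B" for b c
  proof -
    obtain y where y: "y \<in> B" "c = \<theta> y" using \<open>c \<in> \<theta> ` B\<close> by blast
    show ?thesis
      unfolding y(2) coeff_fibre_sum[OF that(1) y(1), symmetric]
      by (rule sum_nonneg) (use coeff_nonneg y in auto)
  qed
  then show ?thesis
    using doob invariant \<eta>_fibre_sum_pos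
      independent_fibre_sums[where B = B and \<theta> = \<theta>, OF basis(1,2) fibre_sum]
    by (auto simp: admits_doob_def)
qed

lemma lumps_weakly_doob_matrix:
  fixes \<alpha> :: "'a \<Rightarrow> real"
  assumes \<mu>: "prob_vector B \<mu>" and init: "\<And>x. x \<in> B \<Longrightarrow> \<mu> x = \<alpha> (\<theta> x) * (\<eta> x / \<eta> (\<theta> x))"
  shows "lumps_weakly TYPE('w) B (doob_matrix UNIV B T \<eta>) \<theta> (\<theta> ` B)
    (doob_matrix (span (\<theta> ` B)) (\<theta> ` B) T \<eta>) \<mu>"
proof (rule lumps_weakly_fibre_weights[where w = "\<lambda>x. \<eta> x / \<eta> (\<theta> x)" and \<alpha> = \<alpha>, OF _ _ \<mu> refl])
  show "\<mu> x = \<alpha> (\<theta> x) * (\<eta> x / \<eta> (\<theta> x))" if "x \<in> B" for x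
    using init[OF that] .
  show "transition_matrix B (doob_matrix UNIV B T \<eta>)"
    by (rule transition_matrix_doob_matrix[OF doob])
  show "transition_matrix (\<theta> ` B) (doob_matrix (span (\<theta> ` B)) (\<theta> ` B) T \<eta>)"
    by (rule transition_matrix_doob_matrix[OF admits_doob_fibre_sums])
  show "(\<Sum>x | x \<in> B \<and> \<theta> x = b. \<eta> x / \<eta> (\<theta> x)) = 1" if b: "b \<in> \<theta> ` B" for b
  proof -
    have "(\<Sum>x | x \<in> B \<and> \<theta> x = b. \<eta> x / \<eta> (\<theta> x)) = (\<Sum>x | x \<in> B \<and> \<theta> x = b. \<eta> x) / \<eta> b"
      by (simp add: sum_divide_distrib)
    then show ?thesis using \<eta>_fibre_sum[OF b] \<eta>_fibre_sum_pos[OF b] by simp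
  qed
  show "(\<Sum>x | x \<in> B \<and> \<theta> x = b. \<eta> x / \<eta> (\<theta> x) * doob_matrix UNIV B T \<eta> x y)
      = doob_matrix (span (\<theta> ` B)) (\<theta> ` B) T \<eta> b (\<theta> y) * (\<eta> y / \<eta> (\<theta> y))"
    if b: "b \<in> \<theta> ` B" and y: "y \<in> B" for b y
  proof -
    obtain \<beta> where \<beta>: "\<beta> > 0" "\<And>v. \<eta> (T v) = \<beta> * \<eta> v"
      using doob by (auto simp: admits_doob_def)
    \<comment> \<open>One scalar serves both spaces; \<open>y\<close> witnesses that the bases are
      nonempty, which makes it unique.\<close>
    have ev: "doob_eigenvalue UNIV T \<eta> = \<beta>" "doob_eigenvalue (span (\<theta> ` B)) T \<eta> = \<beta>"
      by (rule doob_eigenvalue_eqI[OF doob _ \<beta>(1)] doob_eigenvalue_eqI[OF admits_doob_fibre_sums _ \<beta>(1)],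
          use y \<beta>(2) in auto)+
    \<comment> \<open>The weight \<open>\<eta> x\<close> cancels the denominator
      \<open>\<eta> x\<close> of the Doob matrix, leaving the unweighted sum of coefficients over
      the fibre. This explains the choice of weights.\<close>
    have "(\<Sum>x | x \<in> B \<and> \<theta> x = b. \<eta> x / \<eta> (\<theta> x) * doob_matrix UNIV B T \<eta> x y)
        = (\<Sum>x | x \<in> B \<and> \<theta> x = b. \<eta> y / (\<beta> * \<eta> b) * representation B (T x) y)"
    proof (rule sum.cong[OF refl])
      fix x assume x: "x \<in> {x. x \<in> B \<and> \<theta> x = b}"
      then have "\<eta> x > 0" using \<eta>_pos by simp
      with x show "\<eta> x / \<eta> (\<theta> x) * doob_matrix UNIV B T \<eta> x y
          = \<eta> y / (\<beta> * \<eta> b) * representation B (T x) y"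
        unfolding doob_matrix_def ev by (simp add: mult.commute)
    qed
    also have "\<dots> = \<eta> y / (\<beta> * \<eta> b) * representation (\<theta> ` B) (T b) (\<theta> y)"
      by (simp only: sum_distrib_left[symmetric] coeff_fibre_sum[OF b y])
    also have "\<dots> = doob_matrix (span (\<theta> ` B)) (\<theta> ` B) T \<eta> b (\<theta> y) * (\<eta> y / \<eta> (\<theta> y))"
      using \<eta>_fibre_sum_pos[of "\<theta> y"] y unfolding doob_matrix_def ev by simp
    finally show ?thesis .
  qed
qed

end

section \<open>From indexed blocks to the fibres of \<open>\<theta>\<close>\<close>

theorem theorem2p16:
  fixes T :: "'a::real_vector \<Rightarrow> 'a" and \<eta> :: "'a \<Rightarrow> real"
    and \<B> :: "'a set" and I :: "'i set" and block :: "'i \<Rightarrow> 'a set"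
    and xs :: "'i \<Rightarrow> 'a" and \<B>' V' :: "'a set" and \<theta> :: "'a \<Rightarrow> 'a"
  assumes doob: "admits_doob UNIV \<B> T \<eta>"
    and cover: "(\<Union>i\<in>I. block i) = \<B>"
    and disj: "disjoint_family_on block I"
    and nonempty: "\<And>i. i \<in> I \<Longrightarrow> block i \<noteq> {}"
    and xs: "\<And>i. i \<in> I \<Longrightarrow> xs i = (\<Sum>x\<in>block i. x)"
    and \<B>': "\<B>' = xs ` I"
    and V': "V' = span \<B>'"
    and invariant: "T ` V' \<subseteq> V'"
    and \<theta>: "\<And>i x. i \<in> I \<Longrightarrow> x \<in> block i \<Longrightarrow> \<theta> x = xs i"
  shows "admits_doob V' \<B>' T \<eta> \<and>
    (\<forall>\<alpha> :: 'a \<Rightarrow> real. prob_vector \<B> (\<lambda>x. \<alpha> (\<theta> x) * (\<eta> x / \<eta> (\<theta> x))) \<longrightarrow>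
       lumps_weakly TYPE('w) \<B> (doob_matrix UNIV \<B> T \<eta>) \<theta> \<B>' (doob_matrix V' \<B>' T \<eta>)
         (\<lambda>x. \<alpha> (\<theta> x) * (\<eta> x / \<eta> (\<theta> x)))) \<and>
    ((\<forall>x\<in>\<B>. \<eta> x = 1) \<longrightarrow>
       (\<forall>\<mu> :: 'a \<Rightarrow> real. prob_vector \<B> \<mu> \<and> (\<forall>i\<in>I. \<forall>x\<in>block i. \<forall>y\<in>block i. \<mu> x = \<mu> y) \<longrightarrow>
          lumps_weakly TYPE('w) \<B> (doob_matrix UNIV \<B> T \<eta>) \<theta> \<B>' (doob_matrix V' \<B>' T \<eta>) \<mu>))"
proof -
  have fin: "finite \<B>" and ind: "independent \<B>"
    using doob by (auto simp: admits_doob_def)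
  \<comment> \<open>Blocks with equal sums would merge into one fibre of \<open>\<theta>\<close>;
    injectivity excludes this and makes the fibre over \<open>xs i\<close> exactly
    \<open>block i\<close>.\<close>
  have inj: "inj_on xs I"
    using inj_on_block_sums[OF fin ind _ disj nonempty] cover xs
    by (simp add: inj_on_def) (metis UN_upper)
  have img: "\<B>' = \<theta> ` \<B>"
  proof (intro equalityI subsetI)
    fix b assume "b \<in> \<B>'"
    then obtain i where i: "i \<in> I" "b = xs i" using \<B>' by blast
    then obtain x where "x \<in> block i" using nonempty by blast
    with i show "b \<in> \<theta> ` \<B>" using \<theta> cover by force
  next
    fix b assume "b \<in> \<theta> ` \<B>"
    then show "b \<in> \<B>'" using \<theta> cover \<B>' by auto
  qed
  have fibre: "{x. x \<in> \<B> \<and> \<theta> x = xs i} = block i" if "i \<in> I" for i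
    using that \<theta> cover inj by (auto simp: inj_on_def)
  have fibre_sum: "(\<Sum>x | x \<in> \<B> \<and> \<theta> x = b. x) = b" if b: "b \<in> \<theta> ` \<B>" for b
  proof -
    obtain i where "i \<in> I" "b = xs i" using b img \<B>' by auto
    then show ?thesis using fibre xs by simp
  qed
  have inv: "T ` span (\<theta> ` \<B>) \<subseteq> span (\<theta> ` \<B>)"
    using invariant V' img by simp
  have admits: "admits_doob V' \<B>' T \<eta>"
    unfolding V' img
    by (rule admits_doob_fibre_sums[where \<theta> = \<theta>, OF doob]) (simp_all only: fibre_sum inv)
  have lump: "lumps_weakly TYPE('w) \<B> (doob_matrix UNIV \<B> T \<eta>) \<theta> \<B>' (doob_matrix V' \<B>' T \<eta>) \<mu>"
    if \<mu>: "prob_vector \<B> \<mu>" and init: "\<And>x. x \<in> \<B> \<Longrightarrow> \<mu> x = \<alpha> (\<theta> x) * (\<eta> x / \<eta> (\<theta> x))" for \<mu> \<alpha>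
    unfolding V' img
    by (rule lumps_weakly_doob_matrix[where \<theta> = \<theta> and \<alpha> = \<alpha>, OF doob])
      (simp_all only: fibre_sum inv \<mu> init)
  have "lumps_weakly TYPE('w) \<B> (doob_matrix UNIV \<B> T \<eta>) \<theta> \<B>' (doob_matrix V' \<B>' T \<eta>) \<mu>"
    if one: "\<forall>x\<in>\<B>. \<eta> x = 1" and \<mu>: "prob_vector \<B> \<mu>"
      and const: "\<forall>i\<in>I. \<forall>x\<in>block i. \<forall>y\<in>block i. \<mu> x = \<mu> y" for \<mu>
  proof -
    \<comment> \<open>Since \<open>\<mu>\<close> is constant on each block, any chosen point of the
      fibre gives its value. The factor \<open>\<eta> b\<close> cancels the denominator in the
      required form, whose numerator is 1.\<close>
    define \<alpha> where "\<alpha> b = \<mu> (SOME x. x \<in> \<B> \<and> \<theta> x = b) * \<eta> b" for b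
    have "\<mu> x = \<alpha> (\<theta> x) * (\<eta> x / \<eta> (\<theta> x))" if x: "x \<in> \<B>" for x
    proof -
      let ?z = "SOME z. z \<in> \<B> \<and> \<theta> z = \<theta> x"
      have z: "?z \<in> \<B> \<and> \<theta> ?z = \<theta> x" by (rule someI[of _ x]) (use x in simp)
      obtain i where i: "i \<in> I" "x \<in> block i" using x cover by auto
      then have "?z \<in> block i" using fibre[OF i(1)] z \<theta>[OF i] by auto
      then have "\<mu> ?z = \<mu> x" using const i by blast
      moreover have "\<eta> (\<theta> x) > 0"
        using admits x img by (auto simp: admits_doob_def)
      ultimately show ?thesis using one x by (simp add: \<alpha>_def)
    qed
    then show ?thesis by (rule lump[OF \<mu>])
  qed
  moreover have "lumps_weakly TYPE('w) \<B> (doob_matrix UNIV \<B> T \<eta>) \<theta> \<B>' (doob_matrix V' \<B>' T \<eta>)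
      (\<lambda>x. \<alpha> (\<theta> x) * (\<eta> x / \<eta> (\<theta> x)))"
    if "prob_vector \<B> (\<lambda>x. \<alpha> (\<theta> x) * (\<eta> x / \<eta> (\<theta> x)))" for \<alpha>
    by (rule lump[OF that, of \<alpha>]) simp
  ultimately show ?thesis using admits by blast
qed

end
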